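(* Let $q\in C[-b,b]$ be complex valued, let $f$ be a solution of $f''=qf$ on $[-b,b]$ with $f\neq0$ on $[-b,b]$, $f(0)=1$, and $h:=f'(0)$. The following commutation relations hold for the operators $G_1$ and $G_2$ (defined in the context) on $C^1[-b,b]$: $$2\gamma_2\gamma_1G_1=(G_2-\delta)\partial\qquad\text{and}\qquad 2\gamma_2\gamma_1(G_2-\delta)=\big(G_1+(f-2)\delta\big)\partial.$$
   Context: $\partial=d/dx$; $\delta[\eta](x)=\eta(0)$ (constant function); $(f-2)\delta$ is $\eta\mapsto(f-2)\eta(0)$. Kernel: $\mathbf{K}(x,t)=\mathbf{H}\big(\frac{x+t}{2},\frac{x-t}{2}\big)$ on $[-b,b]^2$, where $\mathbf{H}$ is the unique solution of $\frac{\partial^2\mathbf{H}(u,v)}{\partial u\,\partial v}=q(u+v)\mathbf{H}(u,v)$, $\mathbf{H}(u,0)=\frac h2+\frac12\int_0^u q(s)\,ds$, $\mathbf{H}(0,v)=\frac h2$ (equivalently $\mathbf{H}(u,v)=\frac h2+\frac12\int_0^u q(s)\,ds+\int_0^u\int_0^v q(\alpha+\beta)\mathbf{H}(\alpha,\beta)\,d\beta\,d\alpha$). Operators: $G_\pm\eta(x)=\eta(x)+\int_{-x}^x\mathbf{K}(x,t)\left(\eta\left(\frac{t+x}2\right)\pm\eta\left(\frac{t-x}2\right)\right)dt$, $G_1\eta=G_+\left[\eta-\frac{\eta(0)}2\right]+\frac{\eta(0)}2$, $G_2\eta=G_-\eta$ (these formulas make sense for $\eta\in C[-b,b]$). Generalized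 derivative: on $C^1[-b,b]$, $\gamma_2\gamma_1g(x)=\frac12\left(g'(x)-g'(0)-\int_0^xq(s)g(s)\,ds\right)$; this is the extension from $C^2$ of the composition of $\gamma_1g=f^2\frac{d}{dx}\left(\frac gf\right)$ and $\gamma_2g(x)=\frac12\int_0^x\frac{g'(s)}{f(s)}ds$. *)

theory Defs
  imports "HOL-Analysis.Analysis"
begin

text \<open>
  Functions on the compact interval from \<open>-b\<close> to \<open>b\<close> are total functions on the reals of which
  only the values on \<open>{-b..b}\<close> matter; derivatives are relative to the interval, hence one-sided
  at the end points. The integral \<open>LBINT s=u..v. g s\<close> is oriented, so it changes sign when the
  limits are exchanged, and the formulas below are used for negative \<open>x\<close> as well.
\<close>

definition Dx :: "real \<Rightarrow> (real \<Rightarrow> complex) \<Rightarrow> real \<Rightarrow> complex" where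
  "Dx b g x = vector_derivative g (at x within {-b..b})"

definition C1 :: "real \<Rightarrow> (real \<Rightarrow> complex) set" where
  "C1 b = {g. (\<forall>x\<in>{-b..b}. g differentiable (at x within {-b..b})) \<and>
              continuous_on {-b..b} (Dx b g)}"

definition delta :: "(real \<Rightarrow> complex) \<Rightarrow> real \<Rightarrow> complex" where
  "delta \<eta> = (\<lambda>x. \<eta> 0)"

text \<open>
  The map \<open>(x, t) \<mapsto> ((x + t) / 2, (x - t) / 2)\<close> carries the square \<open>[-b, b]\<^sup>2\<close> onto the closed
  diamond \<open>\<bar>u\<bar> + \<bar>v\<bar> \<le> b\<close>. The solution is required to be continuous on the closed diamond; the
  differential equation is imposed in its interior, since at the corners of the diamond the
  partial derivatives make no sense.
  These conditions determine \<open>H\<close> on the diamond, and nowhere else.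
\<close>

definition goursat_solution ::
    "real \<Rightarrow> (real \<Rightarrow> complex) \<Rightarrow> complex \<Rightarrow> (real \<Rightarrow> real \<Rightarrow> complex) \<Rightarrow> bool" where
  "goursat_solution b q h H \<longleftrightarrow>
     continuous_on {(u, v). \<bar>u\<bar> + \<bar>v\<bar> \<le> b} (\<lambda>(u, v). H u v) \<and>
     (\<exists>Hv. \<forall>u v. \<bar>u\<bar> + \<bar>v\<bar> < b \<longrightarrow>
        ((\<lambda>v. H u v) has_vector_derivative Hv u v) (at v) \<and>
        ((\<lambda>u. Hv u v) has_vector_derivative q (u + v) * H u v) (at u)) \<and>
     (\<forall>u\<in>{-b..b}. H u 0 = h / 2 + (1 / 2) * (LBINT s=0..u. q s)) \<and>
     (\<forall>v\<in>{-b..b}. H 0 v = h / 2)"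

definition transmutation_kernel :: "(real \<Rightarrow> real \<Rightarrow> complex) \<Rightarrow> real \<Rightarrow> real \<Rightarrow> complex" where
  "transmutation_kernel H x t = H ((x + t) / 2) ((x - t) / 2)"

definition Gplus :: "(real \<Rightarrow> real \<Rightarrow> complex) \<Rightarrow> (real \<Rightarrow> complex) \<Rightarrow> real \<Rightarrow> complex" where
  "Gplus K \<eta> x = \<eta> x + (LBINT t=-x..x. K x t * (\<eta> ((t + x) / 2) + \<eta> ((t - x) / 2)))"

definition Gminus :: "(real \<Rightarrow> real \<Rightarrow> complex) \<Rightarrow> (real \<Rightarrow> complex) \<Rightarrow> real \<Rightarrow> complex" where
  "Gminus K \<eta> x = \<eta> x + (LBINT t=-x..x. K x t * (\<eta> ((t + x) / 2) - \<eta> ((t - x) / 2)))"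

definition G1 :: "(real \<Rightarrow> real \<Rightarrow> complex) \<Rightarrow> (real \<Rightarrow> complex) \<Rightarrow> real \<Rightarrow> complex" where
  "G1 K \<eta> x = Gplus K (\<lambda>s. \<eta> s - \<eta> 0 / 2) x + \<eta> 0 / 2"

definition G2 :: "(real \<Rightarrow> real \<Rightarrow> complex) \<Rightarrow> (real \<Rightarrow> complex) \<Rightarrow> real \<Rightarrow> complex" where
  "G2 K \<eta> x = Gminus K \<eta> x"

definition gamma1 ::
    "real \<Rightarrow> (real \<Rightarrow> complex) \<Rightarrow> (real \<Rightarrow> complex) \<Rightarrow> real \<Rightarrow> complex" where
  "gamma1 b f g x = (f x)\<^sup>2 * Dx b (\<lambda>s. g s / f s) x"

definition gamma2 ::
    "real \<Rightarrow> (real \<Rightarrow> complex) \<Rightarrow> (real \<Rightarrow> complex) \<Rightarrow> real \<Rightarrow> complex" where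
  "gamma2 b f g x = (1 / 2) * (LBINT s=0..x. Dx b g s / f s)"

text \<open>
  The composition of \<open>gamma1\<close> and \<open>gamma2\<close> needs two derivatives; \<open>gamma21\<close> is its extension to
  \<open>C1\<close>, see \<open>gamma21_eq_comp\<close>.
\<close>

definition gamma21 ::
    "real \<Rightarrow> (real \<Rightarrow> complex) \<Rightarrow> (real \<Rightarrow> complex) \<Rightarrow> real \<Rightarrow> complex" where
  "gamma21 b q g x = (1 / 2) * (Dx b g x - Dx b g 0 - (LBINT s=0..x. q s * g s))"

lemma Dx_eqI:
  assumes "(g has_vector_derivative d) (at x within {-b..b})" "b > 0" "x \<in> {-b..b}"
  shows "Dx b g x = d"
  using assms by (auto simp: Dx_def intro!: vector_derivative_within_cbox[of "-b" b x g d, simplified])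

lemma C1_has_derivative:
  assumes "g \<in> C1 b" "x \<in> {-b..b}"
  shows "(g has_vector_derivative Dx b g x) (at x within {-b..b})"
  using assms by (auto simp: C1_def Dx_def vector_derivative_works)

lemma gamma21_eq_comp:
  assumes b: "b > 0"
    and q: "continuous_on {-b..b} q"
    and f: "f \<in> C1 b" "Dx b f \<in> C1 b" "\<forall>x\<in>{-b..b}. Dx b (Dx b f) x = q x * f x"
    and f0: "\<forall>x\<in>{-b..b}. f x \<noteq> 0"
    and g: "g \<in> C1 b" "Dx b g \<in> C1 b"
    and x: "x \<in> {-b..b}"
  shows "gamma21 b q g x = gamma2 b f (gamma1 b f g) x"
proof -
  let ?I = "{-b..b}"
  let ?w = "\<lambda>s. Dx b g s * f s - g s * Dx b f s"
  have f': "(f has_vector_derivative Dx b f s) (at s within ?I)" 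
    and g': "(g has_vector_derivative Dx b g s) (at s within ?I)" 
    and f'': "(Dx b f has_vector_derivative q s * f s) (at s within ?I)" 
    and g'': "(Dx b g has_vector_derivative Dx b (Dx b g) s) (at s within ?I)"
    if "s \<in> ?I" for s
    using C1_has_derivative[OF f(1) that] C1_has_derivative[OF g(1) that]
      C1_has_derivative[OF f(2) that] C1_has_derivative[OF g(2) that] f(3) that by auto
  have w: "gamma1 b f g s = ?w s" if s: "s \<in> ?I" for s
  proof -
    have "((\<lambda>s. g s / f s) has_vector_derivative ?w s / (f s)\<^sup>2) (at s within ?I)"
      unfolding has_vector_derivative_def
      by (rule has_derivative_eq_rhs[OF has_derivative_divide[
            OF g'[OF s, unfolded has_vector_derivative_def]
               f'[OF s, unfolded has_vector_derivative_def]]])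
         (use f0 s in \<open>auto simp: fun_eq_iff field_simps power2_eq_square scaleR_conv_of_real\<close>)
    then show ?thesis
      using Dx_eqI[of "\<lambda>s. g s / f s" "?w s / (f s)\<^sup>2" s b] b s f0
      by (simp add: gamma1_def)
  qed
  have dw: "Dx b (gamma1 b f g) s / f s = Dx b (Dx b g) s - q s * g s" if s: "s \<in> ?I" for s
  proof -
    have "(?w has_vector_derivative
            (Dx b g s * Dx b f s + Dx b (Dx b g) s * f s) - (g s * (q s * f s) + Dx b g s * Dx b f s))
            (at s within ?I)"
      using f'[OF s] g'[OF s] f''[OF s] g''[OF s]
      by (intro has_vector_derivative_diff has_vector_derivative_mult)
    then have "(gamma1 b f g has_vector_derivative f s * (Dx b (Dx b g) s - q s * g s))
            (at s within ?I)"
      by (rule has_vector_derivative_transform[OF s w, rotated -1, THEN has_vector_derivative_eq_rhs])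
         (simp_all add: algebra_simps)
    then show ?thesis using Dx_eqI b s f0 by auto
  qed
  have sub: "{min 0 x..max 0 x} \<subseteq> ?I" using x b by auto
  have cg: "continuous_on ?I g"
    using g' by (meson continuous_on_eq_continuous_within has_vector_derivative_continuous)
  have cg'': "continuous_on ?I (Dx b (Dx b g))"
    using g(2) by (auto simp: C1_def)
  have int: "interval_lebesgue_integrable lborel (ereal 0) (ereal x) k"
    if "continuous_on ?I k" for k :: "real \<Rightarrow> complex"
  proof (cases "0 \<le> x")
    case True
    then show ?thesis using that sub
      by (intro interval_integrable_continuous_on) (auto intro: continuous_on_subset)
  next
    case False
    then show ?thesis using that sub
      by (subst interval_integrable_endpoints_reverse, intro interval_integrable_continuous_on)
         (auto intro: continuous_on_subset)
  qed
  have "(LBINT s=ereal 0..ereal x. Dx b (gamma1 b f g) s / f s)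
      = (LBINT s=ereal 0..ereal x. Dx b (Dx b g) s - q s * g s)"
    using sub dw by (intro interval_integral_cong) (auto simp: einterval_def min_def max_def split: if_splits)
  also have "\<dots> = (LBINT s=ereal 0..ereal x. Dx b (Dx b g) s) - (LBINT s=ereal 0..ereal x. q s * g s)"
    by (intro interval_lebesgue_integral_diff int cg'' continuous_on_mult q cg)
  also have "(LBINT s=ereal 0..ereal x. Dx b (Dx b g) s) = Dx b g x - Dx b g 0"
    using sub by (intro interval_integral_FTC_finite continuous_on_subset[OF cg'' sub]
        has_vector_derivative_within_subset[OF g'' sub]) auto
  finally show ?thesis
    by (simp add: gamma21_def gamma2_def zero_ereal_def)
qed

end

theory Submission
  imports Defs
begin

text \<open>
  Write \<open>K x t = H u v\<close> with \<open>u = (x + t) / 2\<close> and \<open>v = (x - t) / 2\<close>. The substitution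
  \<open>t = 2 u - x\<close> splits the integrals that define \<open>G1\<close> and \<open>G2\<close> into the two operators
  \<open>A \<eta> x = \<integral> H u (x - u) * \<eta> u du\<close> and \<open>B \<eta> x = \<integral> H (x - v) v * \<eta> (- v) dv\<close>, both over the oriented
  interval from \<open>0\<close> to \<open>x\<close> (they are called \<open>direct\<close> and \<open>reflected\<close> below):
  \<open>G2 \<eta> = \<eta> + 2 (A \<eta> - B \<eta>)\<close> and \<open>G1 \<eta> = \<eta> + 2 (A \<eta> + B \<eta> - \<eta> 0 * B 1)\<close>; the last term comes from
  subtracting \<open>\<eta> 0 / 2\<close> and from \<open>A 1 = B 1\<close>.

  Each operator is differentiated after reversing the variable of integration, so that \<open>x\<close> enters
  through the argument of \<open>\<eta>\<close>: \<open>A \<eta> x = \<integral> H (x - v) v * \<eta> (x - v) dv\<close> and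
  \<open>B \<eta> x = \<integral> H u (x - u) * \<eta> (u - x) du\<close>. There are three contributions. The moving end point gives a
  boundary value of \<open>H\<close> times \<open>\<eta> 0\<close>. The derivative of \<open>\<eta>\<close> gives \<open>A \<eta>'\<close> in one case
  and \<open>- B \<eta>'\<close> in the other; this change of sign is why \<open>G1\<close> and \<open>G2\<close> are interchanged by the
  relations. The derivative of \<open>H\<close> is an integral of \<open>q H\<close> by the Goursat problem (plus \<open>q u / 2\<close> for
  the derivative in \<open>u\<close>, from the data on the axis \<open>v = 0\<close>), and exchanging the order of integration over a
  triangle turns its contribution into an integral of \<open>q * A \<eta>\<close> or \<open>q * B \<eta>\<close>. The result is
    \<open>(A \<eta>)' = A \<eta>' + h / 2 * \<eta> 0 + 1 / 2 * \<integral> q \<eta> + \<integral> q * A \<eta>\<close>  (\<open>direct_deriv\<close>) and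
    \<open>(B \<eta>)' = - B \<eta>' + (h / 2 + 1 / 2 * \<integral> q) * \<eta> 0 + \<integral> q * B \<eta>\<close>  (\<open>reflected_deriv\<close>).
  Combining them, \<open>(G1 \<eta>)' = G2 \<eta>' + h * \<eta> 0 + \<integral> q * G1 \<eta>\<close>, and similarly for \<open>G2 \<eta> - \<eta> 0\<close>;
  the operator \<open>2 * gamma21\<close> removes the last integral and the value at \<open>0\<close>. In the second relation
  \<open>G1 \<eta>'\<close> has to be completed by the multiple \<open>(1 + 2 * B 1) - 2\<close> of \<open>\<eta>' 0\<close>. The function
  \<open>1 + 2 * B 1\<close> satisfies the same equation \<open>y'' = q y\<close> and the same initial conditions as \<open>f\<close>, and it
  is equal to \<open>f\<close> because the quotient by the zero-free \<open>f\<close> has derivative zero (\<open>solution_unique_of_nonvanishing\<close>).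

  All data live on \<open>{-b..b}\<close> or on the closed diamond \<open>\<bar>u\<bar> + \<bar>v\<bar> \<le> b\<close>, and the differential equation for
  \<open>H\<close> is given in the open diamond only. To obtain derivatives up to the end points \<open>-b\<close> and
  \<open>b\<close> without any case distinction, \<open>q\<close>, \<open>H\<close> and \<open>\<eta>'\<close> are extended to continuous functions
  on the line and the plane by Tietze's theorem. The right-hand side of the integral equation,
  formed with the extended data, is a function \<open>Hext\<close> that has continuous partial derivatives
  everywhere and agrees with \<open>H\<close> on the diamond, so all differentiation is done on \<open>Hext\<close>.
\<close>

section \<open>Oriented integrals of continuous functions\<close>

text \<open>
  A constant of its own for the oriented integral with real limits: it keeps the embedding of the
  limits into the extended reals out of sight of the simplifier.
\<close>

definition oint :: "real \<Rightarrow> real \<Rightarrow> (real \<Rightarrow> complex) \<Rightarrow> complex" where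
  "oint a c k = (LBINT s=ereal a..ereal c. k s)"

lemma oint_eq_diff:
  assumes "continuous_on UNIV k" "\<And>s. (F has_vector_derivative k s) (at s)"
  shows "oint a c k = F c - F a"
  unfolding oint_def
  by (intro interval_integral_FTC_finite)
     (auto intro: continuous_on_subset[OF assms(1)] has_vector_derivative_at_within assms(2))

text \<open>
  Every continuous function has an antiderivative on the whole line, so identities between
  oriented integrals reduce to identities between differences \<open>F c - F a\<close>, with no regard to
  the order of the limits.
\<close>

lemma oint_antiderivative:
  assumes "continuous_on UNIV k"
  obtains F where "\<And>s. (F has_vector_derivative k s) (at s)" "\<And>a c. oint a c k = F c - F a"
proof -
  have "\<exists>F. \<forall>x::real. -\<infinity> < ereal x \<longrightarrow> ereal x < \<infinity> \<longrightarrow> (F has_vector_derivative k x) (at x)"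
    using assms by (intro einterval_antiderivative) (auto simp: continuous_on_eq_continuous_at)
  then obtain F where "\<And>x. (F has_vector_derivative k x) (at x)" by auto
  then show thesis using that oint_eq_diff[OF assms] by blast
qed

lemma oint_has_vector_derivative:
  assumes "continuous_on UNIV k"
  shows "((\<lambda>x. oint a x k) has_vector_derivative k x) (at x)"
proof -
  obtain F where F: "\<And>s. (F has_vector_derivative k s) (at s)" "\<And>a c. oint a c k = F c - F a"
    using oint_antiderivative[OF assms] by blast
  show ?thesis unfolding F(2) using has_vector_derivative_diff[OF F(1) has_vector_derivative_const]
    by force
qed

lemma oint_self [simp]: "oint a a k = 0"
  by (simp add: oint_def)

lemma oint_cong:
  assumes "\<And>s. s \<in> closed_segment a c \<Longrightarrow> k s = l s"
  shows "oint a c k = oint a c l"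
  unfolding oint_def using assms
  by (intro interval_integral_cong)
     (auto simp: einterval_def closed_segment_eq_real_ivl min_def max_def split: if_splits)

lemma oint_split:
  assumes "continuous_on UNIV k"
  shows "oint a c k = oint 0 c k - oint 0 a k"
  using oint_antiderivative[OF assms] by (metis (no_types, lifting) diff_diff_eq2 diff_add_cancel)

lemma oint_integrable:
  assumes "continuous_on UNIV k"
  shows "interval_lebesgue_integrable lborel (ereal a) (ereal c) (k :: real \<Rightarrow> complex)"
  using assms by (intro interval_integrable_isCont) (auto simp: continuous_on_eq_continuous_at)

lemma oint_add:
  assumes "continuous_on UNIV k" "continuous_on UNIV l"
  shows "oint a c (\<lambda>s. k s + l s) = oint a c k + oint a c l"
  using assms by (simp add: oint_def oint_integrable)

lemma oint_diff:
  assumes "continuous_on UNIV k" "continuous_on UNIV l"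
  shows "oint a c (\<lambda>s. k s - l s) = oint a c k - oint a c l"
  using assms by (simp add: oint_def oint_integrable)

lemma oint_cmult: "oint a c (\<lambda>s. z * k s) = z * oint a c k"
  by (simp add: oint_def)

lemma oint_divide: "oint a c (\<lambda>s. k s / z) = oint a c k / z"
  by (simp add: oint_def)

lemma oint_affine:
  assumes "continuous_on UNIV k"
  shows "oint a c (\<lambda>s. of_real m * k (m * s + n)) = oint (m * a + n) (m * c + n) k"
proof -
  obtain F where F: "\<And>s. (F has_vector_derivative k s) (at s)" "\<And>a c. oint a c k = F c - F a"
    using oint_antiderivative[OF assms] by blast
  have "((\<lambda>s. F (m * s + n)) has_vector_derivative of_real m * k (m * s + n)) (at s)" for s
  proof -
    have "((\<lambda>s. m * s + n) has_vector_derivative m) (at s)"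
      by (auto intro!: derivative_eq_intros simp: has_real_derivative_iff_has_vector_derivative[symmetric])
    from vector_diff_chain_at[OF this F(1)] show ?thesis
      by (simp add: o_def scaleR_conv_of_real)
  qed
  from oint_eq_diff[OF _ this] show ?thesis
    unfolding F(2) using assms
    by (simp add: continuous_on_compose2[OF assms] continuous_intros)
qed

lemma oint_reflect:
  assumes "continuous_on UNIV k"
  shows "oint 0 x (\<lambda>s. k (x - s)) = oint 0 x k"
proof -
  have "- oint 0 x (\<lambda>s. k (x - s)) = oint x 0 k"
    using oint_affine[OF assms, of 0 x "-1" x] oint_cmult[of 0 x "-1" "\<lambda>s. k (x - s)"] by simp
  then show ?thesis using oint_split[OF assms, of x 0] by simp
qed

lemma oint_shift:
  assumes "continuous_on UNIV k"
  shows "oint a c (\<lambda>s. k (s + n)) = oint (a + n) (c + n) k"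
  using oint_affine[OF assms, of a c 1 n] by simp

text \<open>
  Rescaling to the fixed interval \<open>{0..1}\<close> makes the library results on parametric and iterated
  integrals over boxes available for limits of either sign and for variable limits.
\<close>

lemma oint_unit_interval:
  assumes "continuous_on UNIV k"
  shows "oint 0 x k = of_real x * integral {0..1} (\<lambda>r. k (x * r))"
proof -
  have c: "continuous_on S (\<lambda>r. k (x * r))" for S
    by (intro continuous_on_compose2[OF assms] continuous_intros) auto
  have "oint 0 x k = oint 0 1 (\<lambda>r. of_real x * k (x * r + 0))"
    by (subst oint_affine[OF assms]) simp
  also have "\<dots> = of_real x * oint 0 1 (\<lambda>r. k (x * r))"
    by (simp add: oint_cmult)
  also have "oint 0 1 (\<lambda>r. k (x * r)) = integral {0..1} (\<lambda>r. k (x * r))"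
    unfolding oint_def
    by (intro interval_integral_eq_integral) (auto intro: borel_integrable_atLeastAtMost' c)
  finally show ?thesis .
qed

lemma continuous_on_oint:
  fixes k :: "'a::topological_space \<Rightarrow> real \<Rightarrow> complex"
  assumes k: "continuous_on UNIV (\<lambda>z. k (fst z) (snd z))"
    and c: "continuous_on UNIV c" and e: "continuous_on UNIV e"
  shows "continuous_on UNIV (\<lambda>p. oint (c p) (e p) (k p))"
proof -
  have kp: "continuous_on UNIV (k p)" for p
    using continuous_on_compose2[OF k, of UNIV "\<lambda>s. (p, s)"] by (simp add: continuous_intros)
  have *: "continuous_on UNIV (\<lambda>p. oint 0 (e p) (k p))" if e: "continuous_on UNIV e" for e
  proof -
    have "continuous_on (UNIV \<times> cbox 0 (1::real)) (\<lambda>z. k (fst z) (e (fst z) * snd z))"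
      by (rule continuous_on_compose2[OF k, of _ "\<lambda>z. (fst z, e (fst z) * snd z)", simplified])
         (intro continuous_intros continuous_on_compose2[OF e]; simp)+
    then have "continuous_on UNIV (\<lambda>p. integral (cbox 0 (1::real)) (\<lambda>r. k p (e p * r)))"
      by (intro integral_continuous_on_param) (simp add: case_prod_unfold)
    then have "continuous_on UNIV (\<lambda>p. of_real (e p) * integral {0..1} (\<lambda>r. k p (e p * r)))"
      by (intro continuous_intros e) simp
    then show ?thesis by (simp add: oint_unit_interval[OF kp])
  qed
  show ?thesis
    unfolding oint_split[OF kp, of "c _"]
    by (intro continuous_intros * c e)
qed

lemma continuous_on_compose_pair:
  assumes "continuous_on UNIV (\<lambda>z. k (fst z) (snd z))"
    and "continuous_on S f" "continuous_on S g"
  shows "continuous_on S (\<lambda>x. k (f x) (g x))"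
  using continuous_on_compose2[OF assms(1), of S "\<lambda>x. (f x, g x)"] assms(2,3)
  by (simp add: continuous_intros)

lemma oint_swap_rectangle:
  fixes k :: "real \<Rightarrow> real \<Rightarrow> complex"
  assumes k: "continuous_on UNIV (\<lambda>z. k (fst z) (snd z))"
  shows "oint 0 u (\<lambda>\<alpha>. oint 0 v (\<lambda>\<beta>. k \<alpha> \<beta>)) = oint 0 v (\<lambda>\<beta>. oint 0 u (\<lambda>\<alpha>. k \<alpha> \<beta>))"
proof -
  note kc = continuous_on_compose_pair[OF k]
  have c1: "continuous_on UNIV (\<lambda>\<alpha>. oint 0 v (\<lambda>\<beta>. k \<alpha> \<beta>))"
    and c2: "continuous_on UNIV (\<lambda>\<beta>. oint 0 u (\<lambda>\<alpha>. k \<alpha> \<beta>))"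
    by (intro continuous_on_oint kc continuous_intros)+
  have k1: "continuous_on UNIV (\<lambda>\<beta>. k \<alpha> \<beta>)" and k2: "continuous_on UNIV (\<lambda>\<alpha>. k \<alpha> \<beta>)" for \<alpha> \<beta>
    by (intro kc continuous_intros)+
  have "integral {0..1} (\<lambda>r. integral {0..1} (\<lambda>s. k (u * r) (v * s)))
      = integral {0..1} (\<lambda>s. integral {0..1} (\<lambda>r. k (u * r) (v * s)))"
    using integral_swap_continuous[of 0 0 1 1 "\<lambda>r s. k (u * r) (v * s)"]
    by (simp add: case_prod_unfold kc continuous_intros)
  then show ?thesis
    by (subst oint_unit_interval[OF c1], subst oint_unit_interval[OF c2])
       (simp add: oint_unit_interval[OF k1] oint_unit_interval[OF k2])
qed

text \<open>
  With the upper limit \<open>z\<close> and the parameter \<open>x\<close> kept apart, the integral has both partial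
  derivatives: the one in \<open>z\<close> is the integrand, and for the one in \<open>x\<close> the integrand is written as
  an integral of \<open>k1\<close> and the order of integration is exchanged. The diagonal \<open>z = x\<close>
  then follows by the chain rule.
\<close>

lemma oint_leibniz:
  fixes k k1 :: "real \<Rightarrow> real \<Rightarrow> complex"
  assumes d: "\<And>x v. ((\<lambda>x. k x v) has_vector_derivative k1 x v) (at x)"
    and k: "continuous_on UNIV (\<lambda>z. k (fst z) (snd z))"
    and k1: "continuous_on UNIV (\<lambda>z. k1 (fst z) (snd z))"
  shows "((\<lambda>x. oint 0 x (k x)) has_vector_derivative k x x + oint 0 x (k1 x)) (at x)"
proof -
  note kc = continuous_on_compose_pair[OF k] and k1c = continuous_on_compose_pair[OF k1]
  define P where "P = (\<lambda>x z. oint 0 z (k x))"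
  have kx: "continuous_on UNIV (k x)" for x
    by (intro kc continuous_intros)
  have Pz: "((\<lambda>z. P x z) has_vector_derivative k x z) (at z)" for x z
    unfolding P_def by (rule oint_has_vector_derivative[OF kx])
  have *: "P y z = oint 0 z (k 0) + oint 0 y (\<lambda>t. oint 0 z (k1 t))" for y z
  proof -
    have "P y z = oint 0 z (\<lambda>v. k 0 v + oint 0 y (\<lambda>t. k1 t v))"
      unfolding P_def by (subst oint_eq_diff[OF _ d]) (auto intro: k1c continuous_intros)
    also have "\<dots> = oint 0 z (k 0) + oint 0 z (\<lambda>v. oint 0 y (\<lambda>t. k1 t v))"
      by (intro oint_add kx continuous_on_oint k1c continuous_intros)
    finally show ?thesis using oint_swap_rectangle[OF k1, of y z] by simp
  qed
  have Px: "((\<lambda>x. P x z) has_vector_derivative oint 0 z (k1 x)) (at x)" for z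
    unfolding *
    by (rule has_vector_derivative_add[OF has_vector_derivative_const
          oint_has_vector_derivative, simplified])
       (intro continuous_on_oint k1c continuous_intros)
  have "((\<lambda>(x, z). P x z) has_derivative
      (\<lambda>(tx, tz). tx *\<^sub>R oint 0 x (k1 x) + blinfun_apply (blinfun_scaleR_left (k x x)) tz))
      (at (x, x) within UNIV \<times> UNIV)"
    by (rule has_derivative_partialsI)
       (use Px Pz k in \<open>auto simp: has_vector_derivative_def case_prod_unfold
          continuous_on_eq_continuous_at intro!: continuous_intros\<close>)
  then have "((\<lambda>(x, z). P x z) has_derivative
      (\<lambda>(tx, tz). tx *\<^sub>R oint 0 x (k1 x) + tz *\<^sub>R k x x)) (at (x, x))"
    by simp
  from has_derivative_compose[OF has_derivative_Pair[OF has_derivative_ident has_derivative_ident] this]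
  show ?thesis
    by (simp add: P_def has_vector_derivative_def scaleR_add_right add.commute)
qed

text \<open>
  Both sides vanish at \<open>x = 0\<close> and have the same derivative: in \<open>oint_leibniz\<close> the boundary term of
  the left-hand side is an integral from \<open>x\<close> to \<open>x\<close>.
\<close>

lemma oint_swap_triangle:
  fixes k :: "real \<Rightarrow> real \<Rightarrow> complex"
  assumes k: "continuous_on UNIV (\<lambda>z. k (fst z) (snd z))"
  shows "oint 0 x (\<lambda>v. oint v x (\<lambda>y. k y v)) = oint 0 x (\<lambda>y. oint 0 y (\<lambda>v. k y v))"
proof -
  note kc = continuous_on_compose_pair[OF k]
  have "((\<lambda>x. oint 0 x (\<lambda>v. oint v x (\<lambda>y. k y v))) has_vector_derivative
      oint x x (\<lambda>y. k y x) + oint 0 x (\<lambda>v. k x v)) (at x)" for x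
    by (intro oint_leibniz oint_has_vector_derivative continuous_on_oint kc continuous_intros k)
  then show ?thesis
    using oint_eq_diff[of "\<lambda>y. oint 0 y (\<lambda>v. k y v)" "\<lambda>x. oint 0 x (\<lambda>v. oint v x (\<lambda>y. k y v))" 0 x]
    by (simp add: continuous_on_oint kc continuous_intros)
qed

text \<open>
  A version of the fundamental theorem for a function such as \<open>H u\<close>, which is known to be differentiable
  only inside the diamond and merely continuous up to its boundary.
\<close>

lemma oint_eq_diff_interior:
  assumes k: "continuous_on UNIV k" and F: "continuous_on (closed_segment a c) F"
    and d: "\<And>s. s \<in> open_segment a c \<Longrightarrow> (F has_vector_derivative k s) (at s)"
  shows "oint a c k = F c - F a"
proof -
  have *: "oint a c k = F c - F a"
    if "a \<le> c" "continuous_on {a..c} F" "\<And>s. s \<in> {a<..<c} \<Longrightarrow> (F has_vector_derivative k s) (at s)"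
    for a c
  proof -
    have "oint a c k = integral {a..c} k"
      unfolding oint_def using that(1)
      by (intro interval_integral_eq_integral)
         (auto intro: borel_integrable_atLeastAtMost' continuous_on_subset[OF k])
    also have "\<dots> = F c - F a"
      by (rule integral_unique, rule fundamental_theorem_of_calculus_interior) (use that in auto)
    finally show ?thesis .
  qed
  show ?thesis
  proof (cases "a \<le> c")
    case True
    then show ?thesis using * F d by (simp add: closed_segment_eq_real_ivl open_segment_eq_real_ivl)
  next
    case False
    then have "oint c a k = F a - F c"
      using * F d by (simp add: closed_segment_eq_real_ivl open_segment_eq_real_ivl)
    moreover have "oint a c k = - oint c a k"
      using oint_split[OF k, of a c] oint_split[OF k, of c a] by simp
    ultimately show ?thesis by simp
  qed
qed

section \<open>The integral equation of the Goursat problem\<close>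

text \<open>
  Integrating the equation in \<open>u\<close> from the axis \<open>u = 0\<close>, on which the \<open>v\<close>-derivative of the constant
  \<open>h / 2\<close> is zero, determines the \<open>v\<close>-derivative in the open diamond; integrating that in \<open>v\<close>
  from the axis \<open>v = 0\<close> reaches the closed diamond, since only the end point of the segment
  may lie on the boundary. The integrals are formed with extensions \<open>Q\<close> and \<open>K\<close> of \<open>q\<close>
  and \<open>H\<close>, which makes their integrands continuous everywhere.
\<close>

lemma goursat_solution_integral_equation:
  assumes gs: "goursat_solution b q h H"
    and Q: "continuous_on UNIV Q" "\<And>x. x \<in> {-b..b} \<Longrightarrow> Q x = q x"
    and K: "continuous_on UNIV (\<lambda>z. K (fst z) (snd z))"
      "\<And>u v. \<bar>u\<bar> + \<bar>v\<bar> \<le> b \<Longrightarrow> K u v = H u v"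
    and uv: "\<bar>u\<bar> + \<bar>v\<bar> \<le> b"
  shows "H u v = h / 2 + oint 0 u (\<lambda>\<alpha>. Q \<alpha> / 2 + oint 0 v (\<lambda>\<beta>. Q (\<alpha> + \<beta>) * K \<alpha> \<beta>))"
proof -
  note cont = continuous_on_compose2[OF Q(1)] continuous_on_compose_pair[OF K(1)] continuous_on_oint
    continuous_intros subset_UNIV
  obtain Hv where
    Hv: "\<And>u v. \<bar>u\<bar> + \<bar>v\<bar> < b \<Longrightarrow> ((\<lambda>v. H u v) has_vector_derivative Hv u v) (at v)"
    and Hvu: "\<And>u v. \<bar>u\<bar> + \<bar>v\<bar> < b \<Longrightarrow> ((\<lambda>u. Hv u v) has_vector_derivative q (u + v) * H u v) (at u)"
    using gs unfolding goursat_solution_def by blast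
  have Hu0: "\<And>u. u \<in> {-b..b} \<Longrightarrow> H u 0 = h / 2 + (1 / 2) * oint 0 u q"
    and H0v: "\<And>v. v \<in> {-b..b} \<Longrightarrow> H 0 v = h / 2"
    and Hc: "continuous_on {(u, v). \<bar>u\<bar> + \<bar>v\<bar> \<le> b} (\<lambda>(u, v). H u v)"
    using gs unfolding goursat_solution_def oint_def by (auto simp: zero_ereal_def)
  have Hv0: "Hv 0 v = 0" if "\<bar>v\<bar> < b" for v
  proof -
    have "((\<lambda>v. H 0 v) has_vector_derivative 0) (at v)"
      by (rule has_vector_derivative_transform_within_open[OF has_vector_derivative_const[of "h/2"],
            of "{-b<..<b}"]) (use that H0v in auto)
    with Hv[of 0 v] that show ?thesis
      by (auto intro: vector_derivative_unique_at)
  qed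
  have Hv_eq: "Hv u v = oint 0 u (\<lambda>\<alpha>. Q (\<alpha> + v) * K \<alpha> v)" if uv: "\<bar>u\<bar> + \<bar>v\<bar> < b" for u v
  proof -
    have "((\<lambda>u. Hv u v) has_vector_derivative Q (s + v) * K s v) (at s)" if "s \<in> closed_segment 0 u" for s
    proof -
      have "\<bar>s\<bar> + \<bar>v\<bar> < b" using that uv by (auto simp: closed_segment_eq_real_ivl split: if_splits)
      moreover from this have "s + v \<in> {-b..b}" by auto
      ultimately show ?thesis using Hvu[of s v] K(2)[of s v] Q(2)[of "s + v"] by auto
    qed
    note d = this
    have "oint 0 u (\<lambda>\<alpha>. Q (\<alpha> + v) * K \<alpha> v) = Hv u v - Hv 0 v"
      by (rule oint_eq_diff_interior)
         (auto intro!: cont d intro: open_closed_segment has_vector_derivative_continuous[OF d]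
            continuous_at_imp_continuous_on)
    then show ?thesis using Hv0[of v] uv by simp
  qed
  have "oint 0 v (\<lambda>\<beta>. oint 0 u (\<lambda>\<alpha>. Q (\<alpha> + \<beta>) * K \<alpha> \<beta>)) = H u v - H u 0"
  proof (rule oint_eq_diff_interior)
    show "continuous_on UNIV (\<lambda>\<beta>. oint 0 u (\<lambda>\<alpha>. Q (\<alpha> + \<beta>) * K \<alpha> \<beta>))"
      by (intro cont)
    show "continuous_on (closed_segment 0 v) (H u)"
    proof -
      have "Pair u ` closed_segment 0 v \<subseteq> {(u, v). \<bar>u\<bar> + \<bar>v\<bar> \<le> b}"
        using uv by (auto simp: closed_segment_eq_real_ivl split: if_splits)
      then show ?thesis
        using continuous_on_compose2[OF Hc, of "closed_segment 0 v" "Pair u"]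
        by (simp add: continuous_intros)
    qed
    show "(H u has_vector_derivative oint 0 u (\<lambda>\<alpha>. Q (\<alpha> + s) * K \<alpha> s)) (at s)"
      if "s \<in> open_segment 0 v" for s
    proof -
      have "\<bar>u\<bar> + \<bar>s\<bar> < b" using that uv by (auto simp: open_segment_eq_real_ivl split: if_splits)
      then show ?thesis using Hv[of u s] Hv_eq[of u s] by simp
    qed
  qed
  also have "oint 0 v (\<lambda>\<beta>. oint 0 u (\<lambda>\<alpha>. Q (\<alpha> + \<beta>) * K \<alpha> \<beta>))
      = oint 0 u (\<lambda>\<alpha>. oint 0 v (\<lambda>\<beta>. Q (\<alpha> + \<beta>) * K \<alpha> \<beta>))"
    by (rule oint_swap_rectangle[symmetric]) (intro cont)
  finally have diff: "oint 0 u (\<lambda>\<alpha>. oint 0 v (\<lambda>\<beta>. Q (\<alpha> + \<beta>) * K \<alpha> \<beta>)) = H u v - H u 0" .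
  then have "H u v = h / 2 + (1/2) * oint 0 u q + oint 0 u (\<lambda>\<alpha>. oint 0 v (\<lambda>\<beta>. Q (\<alpha> + \<beta>) * K \<alpha> \<beta>))"
  proof -
    have "u \<in> {-b..b}" using uv by auto
    then show ?thesis using Hu0[of u] diff by (simp add: algebra_simps)
  qed
  also have "oint 0 u q = oint 0 u Q"
  proof (rule oint_cong)
    fix s assume "s \<in> closed_segment 0 u"
    then have "s \<in> {-b..b}"
      using uv by (auto simp: closed_segment_eq_real_ivl split: if_splits)
    then show "q s = Q s" by (rule Q(2)[symmetric])
  qed
  also have "h / 2 + (1/2) * oint 0 u Q + oint 0 u (\<lambda>\<alpha>. oint 0 v (\<lambda>\<beta>. Q (\<alpha> + \<beta>) * K \<alpha> \<beta>)) =
      h / 2 + oint 0 u (\<lambda>\<alpha>. Q \<alpha> / 2 + oint 0 v (\<lambda>\<beta>. Q (\<alpha> + \<beta>) * K \<alpha> \<beta>))"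
    by (subst oint_add) (auto intro!: cont Q(1) simp: oint_divide)
  finally show ?thesis .
qed

section \<open>The two integral operators of the kernel and their derivatives\<close>

text \<open>
  The data are continuous on the line and the plane, while the integral equation is imposed on
  the diamond only. This is the situation after extending the data of the Goursat problem, for
  which the equation has no reason to persist outside the diamond.
\<close>

locale goursat_kernel =
  fixes b :: real and q :: "real \<Rightarrow> complex" and h :: complex and H :: "real \<Rightarrow> real \<Rightarrow> complex"
  assumes q_cont: "continuous_on UNIV q"
    and H_cont: "continuous_on UNIV (\<lambda>z. H (fst z) (snd z))"
    and integral_equation: "\<And>u v. \<bar>u\<bar> + \<bar>v\<bar> \<le> b \<Longrightarrow>
      H u v = h / 2 + oint 0 u (\<lambda>\<alpha>. q \<alpha> / 2 + oint 0 v (\<lambda>\<beta>. q (\<alpha> + \<beta>) * H \<alpha> \<beta>))"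
begin

text \<open>
  \<open>Hext_u\<close> and \<open>Hext_v\<close> are the partial derivatives of \<open>Hext\<close>, which is one Picard step applied to \<open>H\<close>.
  This one step makes it continuously differentiable everywhere, also where \<open>H\<close> does not satisfy
  the integral equation.
\<close>

definition Hext_u :: "real \<Rightarrow> real \<Rightarrow> complex" where
  "Hext_u u v = q u / 2 + oint 0 v (\<lambda>\<beta>. q (u + \<beta>) * H u \<beta>)"

definition Hext_v :: "real \<Rightarrow> real \<Rightarrow> complex" where
  "Hext_v u v = oint 0 u (\<lambda>\<alpha>. q (\<alpha> + v) * H \<alpha> v)"

definition Hext :: "real \<Rightarrow> real \<Rightarrow> complex" where
  "Hext u v = h / 2 + oint 0 u (\<lambda>\<alpha>. Hext_u \<alpha> v)"

text \<open>
  The operators are formed with \<open>H\<close>, not with \<open>Hext\<close>: the inner integrals that arise from \<open>Hext_u\<close> and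
  \<open>Hext_v\<close> contain \<open>H\<close>, and they must be recognised as \<open>direct\<close> and \<open>reflected\<close> at
  every point.
\<close>

definition direct :: "(real \<Rightarrow> complex) \<Rightarrow> real \<Rightarrow> complex" where
  "direct \<eta> x = oint 0 x (\<lambda>u. H u (x - u) * \<eta> u)"

definition reflected :: "(real \<Rightarrow> complex) \<Rightarrow> real \<Rightarrow> complex" where
  "reflected \<eta> x = oint 0 x (\<lambda>v. H (x - v) v * \<eta> (- v))"

lemma q_cont': "continuous_on S f \<Longrightarrow> continuous_on S (\<lambda>x. q (f x))"
  by (rule continuous_on_compose2[OF q_cont]) auto

lemmas H_cont' = continuous_on_compose_pair[OF H_cont]

lemmas data_cont = q_cont' H_cont' continuous_on_oint continuous_intros

lemma Hext_u_cont: "continuous_on UNIV (\<lambda>z. Hext_u (fst z) (snd z))"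
  unfolding Hext_u_def by (intro data_cont; simp)

lemma Hext_v_cont: "continuous_on UNIV (\<lambda>z. Hext_v (fst z) (snd z))"
  unfolding Hext_v_def by (intro data_cont)

lemmas Hext_u_cont' = continuous_on_compose_pair[OF Hext_u_cont]
lemmas Hext_v_cont' = continuous_on_compose_pair[OF Hext_v_cont]

lemma Hext_cont: "continuous_on UNIV (\<lambda>z. Hext (fst z) (snd z))"
  unfolding Hext_def by (intro Hext_u_cont' data_cont)

lemmas Hext_cont' = continuous_on_compose_pair[OF Hext_cont]

lemma H_eq_Hext: "\<bar>u\<bar> + \<bar>v\<bar> \<le> b \<Longrightarrow> H u v = Hext u v"
  unfolding Hext_def Hext_u_def by (rule integral_equation)

lemma Hext_eq: "Hext u v = h / 2 + oint 0 u q / 2 + oint 0 v (Hext_v u)"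
proof -
  have "oint 0 u (\<lambda>\<alpha>. Hext_u \<alpha> v) = oint 0 u (\<lambda>\<alpha>. (1/2) * q \<alpha>) +
     oint 0 u (\<lambda>\<alpha>. oint 0 v (\<lambda>\<beta>. q (\<alpha> + \<beta>) * H \<alpha> \<beta>))"
    by (subst oint_add[symmetric]) ((intro data_cont)+, simp add: Hext_u_def)
  also have "oint 0 u (\<lambda>\<alpha>. oint 0 v (\<lambda>\<beta>. q (\<alpha> + \<beta>) * H \<alpha> \<beta>)) = oint 0 v (Hext_v u)"
    unfolding Hext_v_def[abs_def] by (rule oint_swap_rectangle) (intro data_cont)
  finally show ?thesis by (simp only: oint_cmult Hext_def) simp
qed

lemma Hext_deriv_u: "((\<lambda>u. Hext u v) has_vector_derivative Hext_u u v) (at u)"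
  unfolding Hext_def
  by (rule has_vector_derivative_add[OF has_vector_derivative_const
        oint_has_vector_derivative, simplified]) (intro Hext_u_cont' continuous_intros)

lemma Hext_deriv_v: "((\<lambda>v. Hext u v) has_vector_derivative Hext_v u v) (at v)"
  unfolding Hext_eq
  by (rule has_vector_derivative_add[OF has_vector_derivative_const
        oint_has_vector_derivative, simplified]) (intro Hext_v_cont' continuous_intros)

lemma Hext_0_left: "Hext 0 v = h / 2"
  by (simp add: Hext_def)

lemma Hext_0_right: "Hext u 0 = h / 2 + oint 0 u q / 2"
  by (simp add: Hext_eq)

lemma Hext_eq_H_on_triangle:
  assumes "x \<in> {-b..b}" "u \<in> closed_segment 0 x"
  shows "H u (x - u) = Hext u (x - u)" "H (x - u) u = Hext (x - u) u"
  using assms by (auto intro!: H_eq_Hext simp: closed_segment_eq_real_ivl split: if_splits)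

lemma direct_eq:
  assumes "x \<in> {-b..b}"
  shows "direct \<eta> x = oint 0 x (\<lambda>u. Hext u (x - u) * \<eta> u)"
  unfolding direct_def by (intro oint_cong) (simp add: Hext_eq_H_on_triangle[OF assms])

lemma reflected_eq:
  assumes "x \<in> {-b..b}"
  shows "reflected \<eta> x = oint 0 x (\<lambda>v. Hext (x - v) v * \<eta> (- v))"
  unfolding reflected_def by (intro oint_cong) (simp add: Hext_eq_H_on_triangle[OF assms])

lemma direct_cont:
  assumes "continuous_on UNIV \<eta>"
  shows "continuous_on UNIV (direct \<eta>)"
  unfolding direct_def by (intro data_cont continuous_on_compose2[OF assms]) auto

lemma reflected_cont:
  assumes "continuous_on UNIV \<eta>"
  shows "continuous_on UNIV (reflected \<eta>)"
  unfolding reflected_def by (intro data_cont continuous_on_compose2[OF assms]) auto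

text \<open>
  Here \<open>Hext_u u (x - u)\<close> is \<open>q u / 2\<close> plus the integral of \<open>q s * H u (s - u)\<close> over \<open>s\<close> from \<open>u\<close> to \<open>x\<close>.
  Exchanging the integrals over the triangle between \<open>0\<close>, \<open>u\<close> and \<open>x\<close> makes \<open>s\<close> the outer
  variable, and the inner integral is \<open>direct \<eta> s\<close>.
\<close>

lemma oint_Hext_u_direct:
  assumes "continuous_on UNIV \<eta>"
  shows "oint 0 x (\<lambda>u. Hext_u u (x - u) * \<eta> u)
    = oint 0 x (\<lambda>u. q u * \<eta> u) / 2 + oint 0 x (\<lambda>s. q s * direct \<eta> s)"
proof -
  note cont = data_cont continuous_on_compose2[OF assms]
  have "Hext_u u (x - u) * \<eta> u = (1/2) * (q u * \<eta> u) + oint u x (\<lambda>s. q s * (H u (s - u) * \<eta> u))" for u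
  proof -
    have "oint 0 (x - u) (\<lambda>\<beta>. q (u + \<beta>) * H u \<beta>) = oint u x (\<lambda>s. q s * H u (s - u))"
    proof -
      have "continuous_on UNIV (\<lambda>s. q s * H u (s - u))" by (intro data_cont)
      from oint_shift[OF this, of 0 "x - u" u] show ?thesis by (simp add: add.commute)
    qed
    then show ?thesis
      by (simp add: Hext_u_def algebra_simps flip: oint_cmult)
  qed
  then have "oint 0 x (\<lambda>u. Hext_u u (x - u) * \<eta> u) = oint 0 x (\<lambda>u. (1/2) * (q u * \<eta> u))
      + oint 0 x (\<lambda>u. oint u x (\<lambda>s. q s * (H u (s - u) * \<eta> u)))"
    by (subst oint_add[symmetric]) ((intro cont subset_UNIV)+, simp)
  also have "oint 0 x (\<lambda>u. oint u x (\<lambda>s. q s * (H u (s - u) * \<eta> u)))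
      = oint 0 x (\<lambda>s. oint 0 s (\<lambda>u. q s * (H u (s - u) * \<eta> u)))"
    by (rule oint_swap_triangle) (intro cont subset_UNIV)
  finally show ?thesis
    by (simp only: oint_cmult direct_def) simp
qed

lemma oint_Hext_v_reflected:
  assumes "continuous_on UNIV \<eta>"
  shows "oint 0 x (\<lambda>v. Hext_v (x - v) v * \<eta> (- v)) = oint 0 x (\<lambda>s. q s * reflected \<eta> s)"
proof -
  note cont = data_cont continuous_on_compose2[OF assms]
  have "Hext_v (x - v) v * \<eta> (- v) = oint v x (\<lambda>s. q s * (H (s - v) v * \<eta> (- v)))" for v
  proof -
    have "Hext_v (x - v) v = oint v x (\<lambda>s. q s * H (s - v) v)"
    proof -
      have "continuous_on UNIV (\<lambda>s. q s * H (s - v) v)" by (intro data_cont)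
      from oint_shift[OF this, of 0 "x - v" v] show ?thesis by (simp add: Hext_v_def)
    qed
    then show ?thesis
      by (simp add: algebra_simps flip: oint_cmult)
  qed
  then have "oint 0 x (\<lambda>v. Hext_v (x - v) v * \<eta> (- v))
      = oint 0 x (\<lambda>v. oint v x (\<lambda>s. q s * (H (s - v) v * \<eta> (- v))))"
    by simp
  also have "\<dots> = oint 0 x (\<lambda>s. oint 0 s (\<lambda>v. q s * (H (s - v) v * \<eta> (- v))))"
    by (rule oint_swap_triangle) (intro cont subset_UNIV)
  finally show ?thesis
    by (simp only: oint_cmult reflected_def)
qed

text \<open>
  Reflecting \<open>u\<close> to \<open>x - v\<close> moves \<open>x\<close> from the second argument of the kernel to the first and into
  the argument of \<open>\<eta>\<close>; this is where \<open>\<eta>'\<close> comes from. The end point now contributes the value \<open>h / 2\<close>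
  of the kernel on the axis \<open>u = 0\<close>.
\<close>

lemma direct_deriv:
  assumes d: "\<And>x. (\<eta> has_vector_derivative \<eta>' x) (at x)" and c': "continuous_on UNIV \<eta>'"
    and x: "x \<in> {-b..b}"
  shows "(direct \<eta> has_vector_derivative h / 2 * \<eta> 0 + oint 0 x (\<lambda>s. q s * \<eta> s) / 2
      + oint 0 x (\<lambda>s. q s * direct \<eta> s) + direct \<eta>' x) (at x within {-b..b})"
proof -
  have c: "continuous_on UNIV \<eta>"
    using d by (meson continuous_at_imp_continuous_on has_vector_derivative_continuous)
  note cont = Hext_u_cont' Hext_cont' data_cont continuous_on_compose2[OF c] continuous_on_compose2[OF c']
  let ?k = "\<lambda>x v. Hext (x - v) v * \<eta> (x - v)"
  let ?k1 = "\<lambda>x v. Hext (x - v) v * \<eta>' (x - v) + Hext_u (x - v) v * \<eta> (x - v)"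
  have k: "((\<lambda>x. ?k x v) has_vector_derivative ?k1 x v) (at x)" for x v
  proof -
    have "((\<lambda>x. x - v) has_vector_derivative 1) (at x)"
      by (auto intro!: derivative_eq_intros simp: has_real_derivative_iff_has_vector_derivative[symmetric])
    from vector_diff_chain_at[OF this Hext_deriv_u] vector_diff_chain_at[OF this d]
    show ?thesis by (intro has_vector_derivative_mult) (simp_all add: o_def)
  qed
  have deriv: "((\<lambda>x. oint 0 x (?k x)) has_vector_derivative ?k x x + oint 0 x (?k1 x)) (at x)"
    by (intro oint_leibniz k) (intro cont subset_UNIV)+
  have k1: "oint 0 x (?k1 x) = oint 0 x (\<lambda>u. Hext u (x - u) * \<eta>' u) + oint 0 x (\<lambda>u. Hext_u u (x - u) * \<eta> u)"
  proof -
    have 1: "continuous_on UNIV (\<lambda>u. Hext u (x - u) * \<eta>' u)"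
      and 2: "continuous_on UNIV (\<lambda>u. Hext_u u (x - u) * \<eta> u)"
      by (intro cont subset_UNIV)+
    from oint_reflect[OF continuous_on_add[OF 1 2], of x] oint_add[OF 1 2] show ?thesis by simp
  qed
  have "?k x x + oint 0 x (?k1 x) = h / 2 * \<eta> 0
      + oint 0 x (\<lambda>s. q s * \<eta> s) / 2 + oint 0 x (\<lambda>s. q s * direct \<eta> s) + direct \<eta>' x"
    unfolding k1 oint_Hext_u_direct[OF c] direct_eq[OF x, of \<eta>'] by (simp add: Hext_0_left)
  then have "((\<lambda>x. oint 0 x (?k x)) has_vector_derivative h / 2 * \<eta> 0
      + oint 0 x (\<lambda>s. q s * \<eta> s) / 2 + oint 0 x (\<lambda>s. q s * direct \<eta> s) + direct \<eta>' x) (at x within {-b..b})"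
    using deriv by (simp only: has_vector_derivative_at_within)
  moreover have "direct \<eta> y = oint 0 y (?k y)" if "y \<in> {-b..b}" for y
  proof -
    have "continuous_on UNIV (\<lambda>u. Hext u (y - u) * \<eta> u)" by (intro cont subset_UNIV)
    from oint_reflect[OF this, of y] show ?thesis using that by (simp add: direct_eq)
  qed
  ultimately show ?thesis
    using x by (rule_tac has_vector_derivative_transform) auto
qed

text \<open>
  In the reflected form the argument of \<open>\<eta>\<close> is \<open>u - x\<close>, hence the minus sign of \<open>reflected \<eta>'\<close>. The end
  point contributes the value of the kernel on the axis \<open>v = 0\<close>, which contains the integral of \<open>q\<close>.
\<close>

lemma reflected_deriv:
  assumes d: "\<And>x. (\<eta> has_vector_derivative \<eta>' x) (at x)" and c': "continuous_on UNIV \<eta>'"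
    and x: "x \<in> {-b..b}"
  shows "(reflected \<eta> has_vector_derivative (h / 2 + oint 0 x q / 2) * \<eta> 0
      + oint 0 x (\<lambda>s. q s * reflected \<eta> s) - reflected \<eta>' x) (at x within {-b..b})"
proof -
  have c: "continuous_on UNIV \<eta>"
    using d by (meson continuous_at_imp_continuous_on has_vector_derivative_continuous)
  note cont = Hext_v_cont' Hext_cont' data_cont continuous_on_compose2[OF c] continuous_on_compose2[OF c']
  let ?k = "\<lambda>x u. Hext u (x - u) * \<eta> (u - x)"
  let ?k1 = "\<lambda>x u. Hext u (x - u) * (- \<eta>' (u - x)) + Hext_v u (x - u) * \<eta> (u - x)"
  have k: "((\<lambda>x. ?k x u) has_vector_derivative ?k1 x u) (at x)" for x u
  proof -
    have 1: "((\<lambda>x. x - u) has_vector_derivative 1) (at x)"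
      by (auto intro!: derivative_eq_intros simp: has_real_derivative_iff_has_vector_derivative[symmetric])
    have 2: "((\<lambda>x. u - x) has_vector_derivative - 1) (at x)"
      by (auto intro!: derivative_eq_intros simp: has_real_derivative_iff_has_vector_derivative[symmetric])
    from vector_diff_chain_at[OF 1 Hext_deriv_v] vector_diff_chain_at[OF 2 d]
    show ?thesis by (intro has_vector_derivative_mult) (simp_all add: o_def)
  qed
  have deriv: "((\<lambda>x. oint 0 x (?k x)) has_vector_derivative ?k x x + oint 0 x (?k1 x)) (at x)"
    by (intro oint_leibniz k) (intro cont subset_UNIV)+
  have k1: "oint 0 x (?k1 x) = oint 0 x (\<lambda>v. Hext_v (x - v) v * \<eta> (- v)) - oint 0 x (\<lambda>v. Hext (x - v) v * \<eta>' (- v))"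
  proof -
    have 1: "continuous_on UNIV (\<lambda>v. Hext_v (x - v) v * \<eta> (- v))"
      and 2: "continuous_on UNIV (\<lambda>v. Hext (x - v) v * \<eta>' (- v))"
      by (intro cont subset_UNIV)+
    from oint_reflect[OF continuous_on_diff[OF 1 2], of x] oint_diff[OF 1 2] show ?thesis by simp
  qed
  have "?k x x + oint 0 x (?k1 x) = (h / 2 + oint 0 x q / 2) * \<eta> 0
      + oint 0 x (\<lambda>s. q s * reflected \<eta> s) - reflected \<eta>' x"
    unfolding k1 oint_Hext_v_reflected[OF c] reflected_eq[OF x, of \<eta>'] by (simp add: Hext_0_right)
  then have "((\<lambda>x. oint 0 x (?k x)) has_vector_derivative (h / 2 + oint 0 x q / 2) * \<eta> 0
      + oint 0 x (\<lambda>s. q s * reflected \<eta> s) - reflected \<eta>' x) (at x within {-b..b})"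
    using deriv by (simp only: has_vector_derivative_at_within)
  moreover have "reflected \<eta> y = oint 0 y (?k y)" if "y \<in> {-b..b}" for y
  proof -
    have "continuous_on UNIV (\<lambda>v. Hext (y - v) v * \<eta> (- v))" by (intro cont subset_UNIV)
    from oint_reflect[OF this, of y] show ?thesis using that by (simp add: reflected_eq)
  qed
  ultimately show ?thesis
    using x by (rule_tac has_vector_derivative_transform) auto
qed

lemma direct_one: "direct (\<lambda>_. 1) x = reflected (\<lambda>_. 1) x"
  using oint_reflect[of "\<lambda>u. H u (x - u)" x] by (simp add: direct_def reflected_def H_cont' continuous_intros)

lemma direct_diff_const:
  assumes "continuous_on UNIV \<eta>"
  shows "direct (\<lambda>s. \<eta> s - c) x = direct \<eta> x - c * direct (\<lambda>_. 1) x"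
proof -
  have "direct (\<lambda>s. \<eta> s - c) x = oint 0 x (\<lambda>u. H u (x - u) * \<eta> u - c * (H u (x - u) * 1))"
    unfolding direct_def by (simp add: algebra_simps)
  also have "\<dots> = direct \<eta> x - c * direct (\<lambda>_. 1) x"
    unfolding direct_def oint_cmult[symmetric] by (intro oint_diff data_cont assms)
  finally show ?thesis .
qed

lemma reflected_diff_const:
  assumes "continuous_on UNIV \<eta>"
  shows "reflected (\<lambda>s. \<eta> s - c) x = reflected \<eta> x - c * reflected (\<lambda>_. 1) x"
proof -
  have "reflected (\<lambda>s. \<eta> s - c) x = oint 0 x (\<lambda>v. H (x - v) v * \<eta> (- v) - c * (H (x - v) v * 1))"
    unfolding reflected_def by (simp add: algebra_simps)
  also have "\<dots> = reflected \<eta> x - c * reflected (\<lambda>_. 1) x"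
    unfolding reflected_def oint_cmult[symmetric]
    by (intro oint_diff data_cont continuous_on_compose2[OF assms] subset_UNIV)
  finally show ?thesis .
qed

text \<open>
  The substitution \<open>t = 2 u - x\<close>; the sign \<open>\<sigma>\<close> is \<open>1\<close> for \<open>Gplus\<close> and \<open>-1\<close> for \<open>Gminus\<close>. The functions \<open>K\<close>
  and \<open>\<theta>\<close> are the given ones, \<open>H\<close> and \<open>\<eta>\<close> their extensions.
\<close>

lemma kernel_integral_eq:
  assumes K: "\<forall>u v. \<bar>u\<bar> + \<bar>v\<bar> \<le> b \<longrightarrow> H u v = K u v"
    and \<eta>: "\<forall>s\<in>{-b..b}. \<eta> s = \<theta> s" and c: "continuous_on UNIV \<eta>"
    and x: "x \<in> {-b..b}"
  shows "(LBINT t=-x..x. transmutation_kernel K x t * (\<theta> ((t + x) / 2) + \<sigma> * \<theta> ((t - x) / 2)))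
    = 2 * (direct \<eta> x + \<sigma> * reflected \<eta> x)"
proof -
  note cont = data_cont continuous_on_compose2[OF c]
  let ?l = "\<lambda>u. H u (x - u) * \<eta> u + \<sigma> * (H u (x - u) * \<eta> (u - x))"
  have l: "continuous_on UNIV ?l" by (intro cont subset_UNIV)
  have "(LBINT t=-x..x. transmutation_kernel K x t * (\<theta> ((t + x) / 2) + \<sigma> * \<theta> ((t - x) / 2)))
     = oint (- x) x (\<lambda>t. transmutation_kernel K x t * (\<theta> ((t + x) / 2) + \<sigma> * \<theta> ((t - x) / 2)))"
    by (simp add: oint_def)
  also have "\<dots> = oint (- x) x (\<lambda>t. 2 * (of_real (1/2) * ?l ((1/2) * t + x / 2)))"
  proof (rule oint_cong)
    fix t assume t: "t \<in> closed_segment (- x) x"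
    have e: "(1/2) * t + x / 2 = (t + x) / 2" "x - (t + x) / 2 = (x - t) / 2" "(t + x) / 2 - x = (t - x) / 2"
      "(x + t) / 2 = (t + x) / 2"
      by (simp_all add: field_simps)
    have "\<bar>(t + x) / 2\<bar> + \<bar>(x - t) / 2\<bar> \<le> b" "(t + x) / 2 \<in> {-b..b}" "(t - x) / 2 \<in> {-b..b}"
      using t x by (auto simp: closed_segment_eq_real_ivl field_simps abs_if split: if_splits)
    then show "transmutation_kernel K x t * (\<theta> ((t + x) / 2) + \<sigma> * \<theta> ((t - x) / 2))
        = 2 * (of_real (1/2) * ?l ((1/2) * t + x / 2))"
      unfolding e transmutation_kernel_def using K \<eta> by (simp add: algebra_simps)
  qed
  also have "\<dots> = 2 * oint (- x) x (\<lambda>t. of_real (1/2) * ?l ((1/2) * t + x / 2))"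
    by (rule oint_cmult)
  also have "oint (- x) x (\<lambda>t. of_real (1/2) * ?l ((1/2) * t + x / 2)) = oint 0 x ?l"
    by (subst oint_affine[OF l]) simp
  also have "oint 0 x ?l = direct \<eta> x + \<sigma> * oint 0 x (\<lambda>u. H u (x - u) * \<eta> (u - x))"
    unfolding direct_def oint_cmult[symmetric] by (intro oint_add cont subset_UNIV)
  also have "oint 0 x (\<lambda>u. H u (x - u) * \<eta> (u - x)) = reflected \<eta> x"
  proof -
    have "continuous_on UNIV (\<lambda>u. H u (x - u) * \<eta> (u - x))" by (intro cont subset_UNIV)
    from oint_reflect[OF this, of x] show ?thesis by (simp add: reflected_def)
  qed
  finally show ?thesis .
qed

lemma G2_eq:
  assumes K: "\<forall>u v. \<bar>u\<bar> + \<bar>v\<bar> \<le> b \<longrightarrow> H u v = K u v"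
    and \<eta>: "\<forall>s\<in>{-b..b}. \<eta> s = \<theta> s" and c: "continuous_on UNIV \<eta>"
    and x: "x \<in> {-b..b}"
  shows "G2 (transmutation_kernel K) \<theta> x = \<eta> x + 2 * (direct \<eta> x - reflected \<eta> x)"
  using kernel_integral_eq[OF K \<eta> c x, of "-1"] \<eta> x by (simp add: G2_def Gminus_def)

lemma G1_eq:
  assumes K: "\<forall>u v. \<bar>u\<bar> + \<bar>v\<bar> \<le> b \<longrightarrow> H u v = K u v"
    and \<eta>: "\<forall>s\<in>{-b..b}. \<eta> s = \<theta> s" and c: "continuous_on UNIV \<eta>"
    and x: "x \<in> {-b..b}"
  shows "G1 (transmutation_kernel K) \<theta> x = \<eta> x + 2 * (direct \<eta> x + reflected \<eta> x - \<eta> 0 * reflected (\<lambda>_. 1) x)"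
proof -
  have 0: "\<theta> 0 = \<eta> 0" using x \<eta> by auto
  have "Gplus (transmutation_kernel K) (\<lambda>s. \<theta> s - \<theta> 0 / 2) x = \<eta> x - \<eta> 0 / 2
      + 2 * (direct (\<lambda>s. \<eta> s - \<eta> 0 / 2) x + reflected (\<lambda>s. \<eta> s - \<eta> 0 / 2) x)"
  proof -
    have c2: "continuous_on UNIV (\<lambda>s. \<eta> s - \<eta> 0 / 2)"
      by (intro continuous_on_diff c continuous_on_const)
    have eq: "\<forall>s\<in>{-b..b}. \<eta> s - \<eta> 0 / 2 = \<theta> s - \<theta> 0 / 2"
      by (intro ballI) (simp only: 0 bspec[OF \<eta>])
    show ?thesis
      using kernel_integral_eq[OF K eq c2 x, of 1] bspec[OF \<eta> x] by (simp add: Gplus_def 0)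
  qed
  then show ?thesis
    unfolding direct_diff_const[OF c] reflected_diff_const[OF c] direct_one G1_def 0 by (simp add: algebra_simps)
qed

lemma reflected_one_deriv:
  assumes "x \<in> {-b..b}"
  shows "(reflected (\<lambda>_. 1) has_vector_derivative h / 2 + oint 0 x q / 2 + oint 0 x (\<lambda>s. q s * reflected (\<lambda>_. 1) s))
    (at x within {-b..b})"
proof -
  have "reflected (\<lambda>_. 0) x = 0" by (simp add: reflected_def oint_def)
  then show ?thesis
    using reflected_deriv[of "\<lambda>_. 1" "\<lambda>_. 0" x] assms by simp
qed

text \<open>
  The integrated form of \<open>y'' = q y\<close> with \<open>y' 0 = h\<close> for the function \<open>y = 1 + 2 * reflected 1\<close>, which
  is the image of the constant \<open>1\<close> under \<open>G1\<close>.
\<close>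

lemma one_plus_2_reflected_one_deriv:
  assumes "x \<in> {-b..b}"
  shows "((\<lambda>x. 1 + 2 * reflected (\<lambda>_. 1) x) has_vector_derivative h + oint 0 x (\<lambda>s. q s * (1 + 2 * reflected (\<lambda>_. 1) s)))
    (at x within {-b..b})"
proof -
  have c: "continuous_on UNIV (\<lambda>s. q s * reflected (\<lambda>_. 1) s)"
    by (intro q_cont continuous_intros reflected_cont)
  from has_vector_derivative_add[OF has_vector_derivative_const
      has_vector_derivative_mult_right[OF reflected_one_deriv[OF assms], of 2], of 1]
  show ?thesis
    by (simp add: distrib_left mult.left_commute[of _ 2] oint_add oint_cmult q_cont c continuous_intros add.assoc)
qed

text \<open>
  The two boundary values are \<open>h / 2\<close> and \<open>h / 2\<close> plus half the integral of \<open>q\<close>. The latter occurs in the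
  derivatives of both \<open>reflected \<eta>\<close> and \<open>\<eta> 0 * reflected 1\<close> and cancels, which leaves \<open>h * \<eta> 0\<close>.
\<close>

lemma G1_deriv:
  assumes d: "\<And>x. (\<eta> has_vector_derivative \<eta>' x) (at x)" and c': "continuous_on UNIV \<eta>'"
    and x: "x \<in> {-b..b}"
  shows "((\<lambda>x. \<eta> x + 2 * (direct \<eta> x + reflected \<eta> x - \<eta> 0 * reflected (\<lambda>_. 1) x)) has_vector_derivative
      \<eta>' x + 2 * (direct \<eta>' x - reflected \<eta>' x) + h * \<eta> 0
      + oint 0 x (\<lambda>s. q s * (\<eta> s + 2 * (direct \<eta> s + reflected \<eta> s - \<eta> 0 * reflected (\<lambda>_. 1) s)))) (at x within {-b..b})"
proof -
  have c: "continuous_on UNIV \<eta>"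
    using d by (meson continuous_at_imp_continuous_on has_vector_derivative_continuous)
  have cs: "continuous_on UNIV (\<lambda>s. q s * \<eta> s)" "continuous_on UNIV (\<lambda>s. q s * direct \<eta> s)"
    "continuous_on UNIV (\<lambda>s. q s * reflected \<eta> s)" "continuous_on UNIV (\<lambda>s. q s * reflected (\<lambda>_. 1) s)"
    by (intro q_cont c direct_cont reflected_cont continuous_intros)+
  have "oint 0 x (\<lambda>s. q s * (\<eta> s + 2 * (direct \<eta> s + reflected \<eta> s - \<eta> 0 * reflected (\<lambda>_. 1) s)))
      = oint 0 x (\<lambda>s. q s * \<eta> s + 2 * (q s * direct \<eta> s) + 2 * (q s * reflected \<eta> s) - 2 * \<eta> 0 * (q s * reflected (\<lambda>_. 1) s))"
    by (simp add: algebra_simps)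
  also have "\<dots> = oint 0 x (\<lambda>s. q s * \<eta> s) + 2 * oint 0 x (\<lambda>s. q s * direct \<eta> s)
      + 2 * oint 0 x (\<lambda>s. q s * reflected \<eta> s) - 2 * \<eta> 0 * oint 0 x (\<lambda>s. q s * reflected (\<lambda>_. 1) s)"
    by (simp only: oint_diff oint_add oint_cmult cs continuous_on_add continuous_on_mult_left)
  finally have eq: "oint 0 x (\<lambda>s. q s * (\<eta> s + 2 * (direct \<eta> s + reflected \<eta> s - \<eta> 0 * reflected (\<lambda>_. 1) s))) = \<dots>" .
  show ?thesis
    unfolding eq
    by (rule has_vector_derivative_eq_rhs, rule has_vector_derivative_add[OF has_vector_derivative_at_within[OF d]
      has_vector_derivative_mult_right[OF has_vector_derivative_diff[OF
        has_vector_derivative_add[OF direct_deriv[OF d c' x] reflected_deriv[OF d c' x]]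
        has_vector_derivative_mult_right[OF reflected_one_deriv[OF x], of "\<eta> 0"]], of 2]])
       (simp add: algebra_simps)
qed

text \<open>
  Here the boundary values are subtracted. What remains is \<open>- \<eta> 0\<close> times the integral of \<open>q\<close>, and this is
  the effect of subtracting the constant \<open>\<eta> 0\<close> under the integral of \<open>q * G2 \<eta>\<close>.
\<close>

lemma G2_deriv:
  assumes d: "\<And>x. (\<eta> has_vector_derivative \<eta>' x) (at x)" and c': "continuous_on UNIV \<eta>'"
    and x: "x \<in> {-b..b}"
  shows "((\<lambda>x. \<eta> x + 2 * (direct \<eta> x - reflected \<eta> x) - \<eta> 0) has_vector_derivative
      \<eta>' x + 2 * (direct \<eta>' x + reflected \<eta>' x)
      + oint 0 x (\<lambda>s. q s * (\<eta> s + 2 * (direct \<eta> s - reflected \<eta> s) - \<eta> 0))) (at x within {-b..b})"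
proof -
  have c: "continuous_on UNIV \<eta>"
    using d by (meson continuous_at_imp_continuous_on has_vector_derivative_continuous)
  have cs: "continuous_on UNIV (\<lambda>s. q s * \<eta> s)" "continuous_on UNIV (\<lambda>s. q s * direct \<eta> s)"
    "continuous_on UNIV (\<lambda>s. q s * reflected \<eta> s)" "continuous_on UNIV q"
    by (intro q_cont c direct_cont reflected_cont continuous_intros)+
  have "oint 0 x (\<lambda>s. q s * (\<eta> s + 2 * (direct \<eta> s - reflected \<eta> s) - \<eta> 0))
      = oint 0 x (\<lambda>s. q s * \<eta> s + 2 * (q s * direct \<eta> s) - 2 * (q s * reflected \<eta> s) - \<eta> 0 * q s)"
    by (simp add: algebra_simps)
  also have "\<dots> = oint 0 x (\<lambda>s. q s * \<eta> s) + 2 * oint 0 x (\<lambda>s. q s * direct \<eta> s)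
      - 2 * oint 0 x (\<lambda>s. q s * reflected \<eta> s) - \<eta> 0 * oint 0 x q"
    by (simp only: oint_diff oint_add oint_cmult cs continuous_on_add continuous_on_diff continuous_on_mult_left)
  finally have eq: "oint 0 x (\<lambda>s. q s * (\<eta> s + 2 * (direct \<eta> s - reflected \<eta> s) - \<eta> 0)) = \<dots>" .
  show ?thesis
    unfolding eq
    by (rule has_vector_derivative_eq_rhs, rule has_vector_derivative_diff[OF has_vector_derivative_add[OF has_vector_derivative_at_within[OF d]
      has_vector_derivative_mult_right[OF has_vector_derivative_diff[OF direct_deriv[OF d c' x] reflected_deriv[OF d c' x]], of 2]]
      has_vector_derivative_const[of "\<eta> 0"]])
       (simp add: algebra_simps)
qed

end

section \<open>Passage to the interval\<close>

text \<open>
  If the derivative of a function is known as a formula \<open>D\<close> up to the end points, then \<open>gamma21\<close> is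
  read off from \<open>D\<close>. The data \<open>G\<close> and \<open>Q\<close> are extensions, which may differ from \<open>g\<close> and
  \<open>q\<close> outside the interval.
\<close>

lemma C1_gamma21I:
  assumes b: "b > 0"
    and g: "\<forall>x\<in>{-b..b}. g x = G x"
    and D: "\<forall>x\<in>{-b..b}. (G has_vector_derivative D x) (at x within {-b..b})"
      "continuous_on {-b..b} D"
    and Q: "\<forall>x\<in>{-b..b}. Q x = q x"
  shows "g \<in> C1 b"
    and "x \<in> {-b..b} \<Longrightarrow> 2 * gamma21 b q g x = D x - D 0 - oint 0 x (\<lambda>s. Q s * G s)"
proof -
  have d: "(g has_vector_derivative D x) (at x within {-b..b})" if "x \<in> {-b..b}" for x
    using has_vector_derivative_transform[OF that bspec[OF g] bspec[OF D(1) that]] .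
  have Dx: "Dx b g x = D x" if "x \<in> {-b..b}" for x
    using Dx_eqI[OF d[OF that] b that] .
  have "continuous_on {-b..b} (Dx b g)"
    by (rule continuous_on_eq[OF D(2)]) (simp only: Dx)
  then show "g \<in> C1 b"
    using differentiableI_vector[OF d] by (simp add: C1_def)
  assume x: "x \<in> {-b..b}"
  have "(LBINT s=0..x. q s * g s) = oint 0 x (\<lambda>s. q s * g s)"
    by (simp add: oint_def zero_ereal_def)
  also have "\<dots> = oint 0 x (\<lambda>s. Q s * G s)"
  proof (rule oint_cong)
    fix s assume "s \<in> closed_segment 0 x"
    then have "s \<in> {-b..b}"
      using x by (auto simp: closed_segment_eq_real_ivl split: if_splits)
    then show "q s * g s = Q s * G s" using g Q by simp
  qed
  finally show "2 * gamma21 b q g x = D x - D 0 - oint 0 x (\<lambda>s. Q s * G s)"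
    using Dx[OF x] Dx[of 0] b by (simp add: gamma21_def)
qed

text \<open>
  Extending the derivative continuously and integrating it keeps the two extensions consistent.
\<close>

lemma C1_extension:
  assumes b: "b > 0" and \<eta>: "\<eta> \<in> C1 b"
  obtains \<zeta> \<zeta>' where "\<And>x. (\<zeta> has_vector_derivative \<zeta>' x) (at x)" "continuous_on UNIV \<zeta>'"
    "\<And>x. x \<in> {-b..b} \<Longrightarrow> \<zeta> x = \<eta> x" "\<And>x. x \<in> {-b..b} \<Longrightarrow> \<zeta>' x = Dx b \<eta> x"
proof -
  have "continuous_on {-b..b} (Dx b \<eta>)" using \<eta> by (simp add: C1_def)
  then obtain \<zeta>' where \<zeta>': "continuous_on UNIV \<zeta>'" "\<And>x. x \<in> {-b..b} \<Longrightarrow> \<zeta>' x = Dx b \<eta> x"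
    by (rule Tietze_unbounded[where U = UNIV]) (auto simp flip: closed_closedin)
  have "oint 0 x \<zeta>' = \<eta> x - \<eta> 0" if x: "x \<in> {-b..b}" for x
  proof (rule oint_eq_diff_interior[OF \<zeta>'(1)])
    have sub: "closed_segment 0 x \<subseteq> {-b..b}"
      using x b by (auto simp: closed_segment_eq_real_ivl split: if_splits)
    have "continuous_on {-b..b} \<eta>"
      using C1_has_derivative[OF \<eta>] by (meson continuous_on_eq_continuous_within has_vector_derivative_continuous)
    then show "continuous_on (closed_segment 0 x) \<eta>" using sub by (rule continuous_on_subset)
    fix s assume "s \<in> open_segment 0 x"
    then have "- b < s" "s < b"
      using x by (auto simp: open_segment_eq_real_ivl split: if_splits)
    then show "(\<eta> has_vector_derivative \<zeta>' s) (at s)"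
      using C1_has_derivative[OF \<eta>, of s] \<zeta>'(2)[of s] by (simp add: at_within_Icc_at)
  qed
  moreover have "((\<lambda>x. \<eta> 0 + oint 0 x \<zeta>') has_vector_derivative \<zeta>' x) (at x)" for x
    using has_vector_derivative_add[OF has_vector_derivative_const oint_has_vector_derivative[OF \<zeta>'(1)]]
    by force
  ultimately show thesis using that[of "\<lambda>x. \<eta> 0 + oint 0 x \<zeta>'" \<zeta>'] \<zeta>' by auto
qed

section \<open>The commutation relations\<close>

text \<open>
  The Wronskian of two solutions is constant, and it is zero by the initial conditions. Therefore
  the quotient by the zero-free solution is constant, equal to its initial value \<open>1\<close>.
\<close>

lemma solution_unique_of_nonvanishing:
  fixes f g f1 g1 q :: "real \<Rightarrow> complex"
  assumes I: "convex I" "a \<in> I"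
    and f: "\<And>x. x \<in> I \<Longrightarrow> (f has_vector_derivative f1 x) (at x within I)"
      "\<And>x. x \<in> I \<Longrightarrow> (f1 has_vector_derivative q x * f x) (at x within I)"
    and g: "\<And>x. x \<in> I \<Longrightarrow> (g has_vector_derivative g1 x) (at x within I)"
      "\<And>x. x \<in> I \<Longrightarrow> (g1 has_vector_derivative q x * g x) (at x within I)"
    and nz: "\<And>x. x \<in> I \<Longrightarrow> f x \<noteq> 0"
    and init: "g a = f a" "g1 a = f1 a"
    and x: "x \<in> I"
  shows "g x = f x"
proof -
  let ?w = "\<lambda>x. g1 x * f x - g x * f1 x"
  have "(?w has_vector_derivative 0) (at s within I)" if "s \<in> I" for s
    using has_vector_derivative_diff[OF has_vector_derivative_mult[OF g(2) f(1)]
        has_vector_derivative_mult[OF g(1) f(2)], OF that that that that]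
    by (simp add: algebra_simps)
  then obtain c where "\<And>s. s \<in> I \<Longrightarrow> ?w s = c"
    using has_vector_derivative_zero_constant[OF I(1)] by blast
  then have w: "?w s = 0" if "s \<in> I" for s
    using that I(2) init by (metis mult.commute right_minus_eq)
  have "((\<lambda>s. g s / f s) has_vector_derivative 0) (at s within I)" if s: "s \<in> I" for s
    unfolding has_vector_derivative_def
    by (rule has_derivative_eq_rhs[OF has_derivative_divide[
          OF g(1)[OF s, unfolded has_vector_derivative_def]
             f(1)[OF s, unfolded has_vector_derivative_def]]])
       (use nz s w[OF s] in \<open>auto simp: fun_eq_iff field_simps scaleR_conv_of_real\<close>)
  then obtain c where "\<And>s. s \<in> I \<Longrightarrow> g s / f s = c"
    using has_vector_derivative_zero_constant[OF I(1)] by blast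
  from this[OF x] this[OF I(2)] show ?thesis
    using nz[OF x] nz[OF I(2)] init(1) by simp
qed

theorem corollary6p4:
  fixes b :: real and q f :: "real \<Rightarrow> complex" and h :: complex
    and H :: "real \<Rightarrow> real \<Rightarrow> complex"
  assumes "b > 0"
    and "continuous_on {-b..b} q"
    and "f \<in> C1 b" and "Dx b f \<in> C1 b"
    and "\<forall>x\<in>{-b..b}. Dx b (Dx b f) x = q x * f x"
    and "\<forall>x\<in>{-b..b}. f x \<noteq> 0"
    and "f 0 = 1" and "h = Dx b f 0"
    and "goursat_solution b q h H"
  shows "\<forall>\<eta>\<in>C1 b.
     G1 (transmutation_kernel H) \<eta> \<in> C1 b \<and>
     (\<forall>x\<in>{-b..b}. 2 * gamma21 b q (G1 (transmutation_kernel H) \<eta>) x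
        = G2 (transmutation_kernel H) (Dx b \<eta>) x - delta (Dx b \<eta>) x) \<and>
     (\<lambda>s. G2 (transmutation_kernel H) \<eta> s - delta \<eta> s) \<in> C1 b \<and>
     (\<forall>x\<in>{-b..b}. 2 * gamma21 b q (\<lambda>s. G2 (transmutation_kernel H) \<eta> s - delta \<eta> s) x
        = G1 (transmutation_kernel H) (Dx b \<eta>) x + (f x - 2) * delta (Dx b \<eta>) x)"
proof
  fix \<eta> assume \<eta>: "\<eta> \<in> C1 b"
  obtain Q where Q: "continuous_on UNIV Q" "\<And>x. x \<in> {-b..b} \<Longrightarrow> Q x = q x"
    by (rule Tietze_unbounded[OF assms(2), of UNIV]) (auto simp flip: closed_closedin)
  have "closed {(u::real, v). \<bar>u\<bar> + \<bar>v\<bar> \<le> b}"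
    by (simp add: case_prod_unfold closed_Collect_le continuous_intros)
  moreover have "continuous_on {(u, v). \<bar>u\<bar> + \<bar>v\<bar> \<le> b} (\<lambda>(u, v). H u v)"
    using assms(9) by (simp add: goursat_solution_def)
  ultimately obtain K0 where K0: "continuous_on UNIV K0"
      "\<And>z. z \<in> {(u, v). \<bar>u\<bar> + \<bar>v\<bar> \<le> b} \<Longrightarrow> K0 z = (case z of (u, v) \<Rightarrow> H u v)"
    by (rule_tac Tietze_unbounded[where U = UNIV]) (auto simp flip: closed_closedin)
  define K where "K = (\<lambda>u v. K0 (u, v))"
  have K: "continuous_on UNIV (\<lambda>z. K (fst z) (snd z))"
      "\<And>u v. \<bar>u\<bar> + \<bar>v\<bar> \<le> b \<Longrightarrow> K u v = H u v"
    using K0 by (simp_all add: K_def)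
  interpret goursat_kernel b Q h K
  proof
    fix u v :: real assume uv: "\<bar>u\<bar> + \<bar>v\<bar> \<le> b"
    show "K u v = h / 2 + oint 0 u (\<lambda>\<alpha>. Q \<alpha> / 2 + oint 0 v (\<lambda>\<beta>. Q (\<alpha> + \<beta>) * K \<alpha> \<beta>))"
      by (subst K(2)[OF uv]) (rule goursat_solution_integral_equation[OF assms(9) Q K uv])
  qed (fact Q(1) K(1))+
  obtain \<zeta> \<zeta>' where d: "\<And>x. (\<zeta> has_vector_derivative \<zeta>' x) (at x)" and c': "continuous_on UNIV \<zeta>'"
    and \<zeta>: "\<And>x. x \<in> {-b..b} \<Longrightarrow> \<zeta> x = \<eta> x" and \<zeta>': "\<And>x. x \<in> {-b..b} \<Longrightarrow> \<zeta>' x = Dx b \<eta> x"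
    by (rule C1_extension[OF assms(1) \<eta>]) blast
  have c: "continuous_on UNIV \<zeta>"
    using d by (meson continuous_at_imp_continuous_on has_vector_derivative_continuous)
  have at0: "\<eta> 0 = \<zeta> 0" "Dx b \<eta> 0 = \<zeta>' 0"
    using \<zeta>[of 0] \<zeta>'[of 0] assms(1) by auto
  have at_zero: "direct \<theta> 0 = 0" "reflected \<theta> 0 = 0" for \<theta>
    by (simp_all add: direct_def reflected_def)
  have f: "f x = 1 + 2 * reflected (\<lambda>_. 1) x" if x: "x \<in> {-b..b}" for x
  proof -
    let ?g = "\<lambda>x. 1 + 2 * reflected (\<lambda>_. 1) x"
    let ?g1 = "\<lambda>x. h + oint 0 x (\<lambda>s. Q s * ?g s)"
    have f1: "(f has_vector_derivative Dx b f s) (at s within {-b..b})" if "s \<in> {-b..b}" for s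
      using C1_has_derivative[OF assms(3) that] .
    have f2: "(Dx b f has_vector_derivative Q s * f s) (at s within {-b..b})" if "s \<in> {-b..b}" for s
      using C1_has_derivative[OF assms(4) that] assms(5) that Q(2)[OF that] by simp
    have "continuous_on UNIV (\<lambda>s. Q s * ?g s)"
      by (intro Q(1) continuous_intros reflected_cont)
    from has_vector_derivative_add[OF has_vector_derivative_const[of h] oint_has_vector_derivative[OF this]]
    have g2: "(?g1 has_vector_derivative Q s * ?g s) (at s within {-b..b})" for s
      by (simp only: add_0_left has_vector_derivative_at_within)
    show ?thesis
      using solution_unique_of_nonvanishing[of "{-b..b}" 0 f "Dx b f" Q ?g ?g1 x,
          OF _ _ f1 f2 one_plus_2_reflected_one_deriv g2] assms(1,6-8) x at_zero(2)
      by simp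
  qed
  have G1C: "continuous_on {-b..b} (\<lambda>x. \<zeta>' x + 2 * (direct \<zeta>' x - reflected \<zeta>' x) + h * \<zeta> 0
      + oint 0 x (\<lambda>s. Q s * (\<zeta> s + 2 * (direct \<zeta> s + reflected \<zeta> s - \<zeta> 0 * reflected (\<lambda>_. 1) s))))"
    and G2C: "continuous_on {-b..b} (\<lambda>x. \<zeta>' x + 2 * (direct \<zeta>' x + reflected \<zeta>' x)
      + oint 0 x (\<lambda>s. Q s * (\<zeta> s + 2 * (direct \<zeta> s - reflected \<zeta> s) - \<zeta> 0)))"
    by (rule continuous_on_subset[OF _ subset_UNIV],
        intro continuous_on_compose2[OF direct_cont[OF c]] continuous_on_compose2[OF reflected_cont[OF c]]
          continuous_on_compose2[OF reflected_cont[OF continuous_on_const]] continuous_on_compose2[OF c]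
          direct_cont reflected_cont c c' data_cont subset_UNIV)+
  have K': "\<forall>u v. \<bar>u\<bar> + \<bar>v\<bar> \<le> b \<longrightarrow> K u v = H u v" using K(2) by blast
  have Q': "\<forall>x\<in>{-b..b}. Q x = q x" using Q(2) by blast
  have ext: "\<forall>x\<in>{-b..b}. \<zeta> x = \<eta> x" "\<forall>x\<in>{-b..b}. \<zeta>' x = Dx b \<eta> x" using \<zeta> \<zeta>' by blast+
  note r1 = C1_gamma21I[OF assms(1) ballI[OF G1_eq[OF K' ext(1) c]] ballI[OF G1_deriv[OF d c']] G1C Q']
  have "\<forall>x\<in>{-b..b}. G2 (transmutation_kernel H) \<eta> x - delta \<eta> x = \<zeta> x + 2 * (direct \<zeta> x - reflected \<zeta> x) - \<zeta> 0"
    using G2_eq[OF K' ext(1) c] by (simp add: delta_def at0)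
  note r2 = C1_gamma21I[OF assms(1) this ballI[OF G2_deriv[OF d c']] G2C Q']
  have "2 * gamma21 b q (G1 (transmutation_kernel H) \<eta>) x
        = G2 (transmutation_kernel H) (Dx b \<eta>) x - delta (Dx b \<eta>) x" if x: "x \<in> {-b..b}" for x
    using r1(2)[of x] x G2_eq[OF K' ext(2) c' x] by (simp add: delta_def at0 at_zero)
  moreover have "2 * gamma21 b q (\<lambda>s. G2 (transmutation_kernel H) \<eta> s - delta \<eta> s) x
        = G1 (transmutation_kernel H) (Dx b \<eta>) x + (f x - 2) * delta (Dx b \<eta>) x" if x: "x \<in> {-b..b}" for x
    using r2(2)[of x] x G1_eq[OF K' ext(2) c' x] f[OF x]
    by (simp add: delta_def at0 at_zero algebra_simps)
  moreover note r1(1) r2(1)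
  ultimately show "G1 (transmutation_kernel H) \<eta> \<in> C1 b \<and>
     (\<forall>x\<in>{-b..b}. 2 * gamma21 b q (G1 (transmutation_kernel H) \<eta>) x
        = G2 (transmutation_kernel H) (Dx b \<eta>) x - delta (Dx b \<eta>) x) \<and>
     (\<lambda>s. G2 (transmutation_kernel H) \<eta> s - delta \<eta> s) \<in> C1 b \<and>
     (\<forall>x\<in>{-b..b}. 2 * gamma21 b q (\<lambda>s. G2 (transmutation_kernel H) \<eta> s - delta \<eta> s) x
        = G1 (transmutation_kernel H) (Dx b \<eta>) x + (f x - 2) * delta (Dx b \<eta>) x)"
    by blast
qed

end
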